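(* Let $I\subseteq \mathbb{F}_q[X_1,\ldots,X_m]$ be an ideal, $\prec$ a monomial ordering, and $\Delta_\prec(I_q)=\{M_1,\ldots,M_n\}$ with $M_1\prec\cdots\prec M_n$. For $i=1,\ldots,n$ let $\mu(M_i)$ be a lower bound estimate on $\#\Lambda(M_i)$, i.e. $\mu(M_i)\le \#\Lambda(M_i)$. (1) Let $L\subseteq\Delta_\prec(I_q)$. Then the minimum distance of $C^\perp(I,L)$ is at least $$\min\{\mu(M)\mid M\in\Delta_\prec(I_q),\ M\notin L\}.$$ (2) Let $L_2\subsetneq L_1\subseteq\Delta_\prec(I_q)$ and define $m(L_1)=\max\{i\mid M_i\in L_1\}$. Then the relative distance $d(C^\perp(I,L_2),C^\perp(I,L_1))$ is greater than or equal to $$\min\{\mu(M_i)\mid M_i\notin L_2,\ i\le m(L_1)\}.$$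
   Context: $\mathbb{F}_q$ is the finite field with $q$ elements. For an ideal $J$ of $\mathbb{F}_q[X_1,\ldots,X_m]$ the footprint $\Delta_\prec(J)$ is the set of monomials that are not the leading monomial (w.r.t. $\prec$) of any polynomial in $J$. For an ideal $I$ put $I_q=I+\langle X_1^q-X_1,\ldots,X_m^q-X_m\rangle$. The variety $\mathbb{V}(I_q)=\{P_1,\ldots,P_n\}\subseteq\mathbb{F}_q^m$ is finite, $n=\#\Delta_\prec(I_q)$, and $\mathrm{ev}(F)=(F(P_1),\ldots,F(P_n))\in\mathbb{F}_q^n$ for a polynomial $F$; this induces an isomorphism $\mathbb{F}_q[X_1,\ldots,X_m]/I_q\to\mathbb{F}_q^n$ of vector spaces. For $L\subseteq\Delta_\prec(I_q)$, $C(I,L)=\mathrm{Span}_{\mathbb{F}_q}\{\mathrm{ev}(M)\mid M\in L\}$, and $C^\perp(I,L)$ is its dual code with respect to the standard bilinear form on $\mathbb{F}_q^n$. $\mathrm{lm}(F)$ is the leading monomial of $F$ w.r.t. $\prec$, and $\mathrm{Supp}(F)$ is the set of monomials with nonzero coefficient in $F$. $\Lambda(M_i)$ is the set of all $M\in\Delta_\prec(I_q)$ such that for every $F$ with $\mathrm{lm}(F)=M$ and $\mathrm{Supp}(F)\subseteq\Delta_\prec(I_q)$ there is a polynomial of the form $KF+\sum_{j=1}^s P_jH_j$ with leading monomial equal to $M_i$, where $K,P_1,\ldots,P_s$ are arbitrary polynomials and $\{H_1,\ldots,H_s\}$ is a Gröbner basis for $I_q$ w.r.t. $\prec$ (equivalently,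 there is a polynomial in the ideal $\langle F\rangle+I_q$ with leading monomial $M_i$). For nested linear codes $C''\subsetneq C'$ the relative distance is $d(C',C'')=\min\{w_H(\vec c)\mid \vec c\in C'\setminus C''\}$, where $w_H$ denotes Hamming weight. *)

theory Defs
  imports
    "HOL-Library.Poly_Mapping"
    "HOL-Library.Cardinality"
    "HOL-Library.Extended_Nat"
    "Jordan_Normal_Form.VS_Connect"
begin

type_synonym 'm monomial = "'m \<Rightarrow>\<^sub>0 nat"
type_synonym ('m, 'a) mpoly = "'m monomial \<Rightarrow>\<^sub>0 'a"

definition peval :: "('m::finite, 'a::comm_ring_1) mpoly \<Rightarrow> ('m \<Rightarrow> 'a) \<Rightarrow> 'a" where
  "peval F x = (\<Sum>t\<in>Poly_Mapping.keys F. Poly_Mapping.lookup F t * (\<Prod>i\<in>UNIV. x i ^ Poly_Mapping.lookup t i))"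

text \<open>Ideals are the submodules of the ring, regarded as a module over itself.\<close>

lemma module_self: "Modules.module ((*) :: 'r::comm_ring_1 \<Rightarrow> 'r \<Rightarrow> 'r)"
  by (rule Modules.module.intro) (simp_all add: algebra_simps)

definition is_ideal :: "'r::comm_ring_1 set \<Rightarrow> bool" where
  "is_ideal J \<longleftrightarrow> Modules.module.subspace (*) J"

definition ideal_gen :: "'r::comm_ring_1 set \<Rightarrow> 'r set" where
  "ideal_gen B = Modules.module.span (*) B"

definition indet :: "'m \<Rightarrow> ('m, 'a::comm_ring_1) mpoly" where
  "indet i = Poly_Mapping.single (Poly_Mapping.single i 1) 1"

definition field_ideal :: "('m, 'a::{field,finite}) mpoly set \<Rightarrow> ('m, 'a) mpoly set" where
  "field_ideal I = {F + G | F G. F \<in> I \<and> G \<in> ideal_gen (range (\<lambda>i. indet i ^ CARD('a) - indet i))}"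

definition variety :: "('m::finite, 'a::comm_ring_1) mpoly set \<Rightarrow> ('m \<Rightarrow> 'a) set" where
  "variety J = {x. \<forall>F\<in>J. peval F x = 0}"

text \<open>Strict monomial orderings; monomials are written as exponent vectors, so that their
  product is the sum of the exponents.\<close>

definition monomial_ordering :: "('m monomial \<Rightarrow> 'm monomial \<Rightarrow> bool) \<Rightarrow> bool" where
  "monomial_ordering prec \<longleftrightarrow> irreflp prec \<and> transp prec \<and> totalp prec \<and>
     (\<forall>s t u. prec s t \<longrightarrow> prec (s + u) (t + u)) \<and> wfp prec"

text \<open>Only meaningful for nonzero polynomials.\<close>

definition lm :: "('m monomial \<Rightarrow> 'm monomial \<Rightarrow> bool) \<Rightarrow> ('m, 'a::zero) mpoly \<Rightarrow> 'm monomial" where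
  "lm prec F = (THE t. t \<in> Poly_Mapping.keys F \<and> (\<forall>s\<in>Poly_Mapping.keys F. s \<noteq> t \<longrightarrow> prec s t))"

definition footprint ::
    "('m monomial \<Rightarrow> 'm monomial \<Rightarrow> bool) \<Rightarrow> ('m, 'a::zero) mpoly set \<Rightarrow> 'm monomial set" where
  "footprint prec J = {t. \<nexists>F. F \<in> J \<and> F \<noteq> 0 \<and> lm prec F = t}"

definition groebner_basis ::
    "('m monomial \<Rightarrow> 'm monomial \<Rightarrow> bool) \<Rightarrow> ('m, 'a::field) mpoly set \<Rightarrow> ('m, 'a) mpoly set \<Rightarrow> bool"
  where
  "groebner_basis prec J H \<longleftrightarrow> finite H \<and> H \<subseteq> J \<and>
     ideal_gen {Poly_Mapping.single (lm prec F) (1::'a) | F. F \<in> H \<and> F \<noteq> 0} =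
     ideal_gen {Poly_Mapping.single (lm prec F) (1::'a) | F. F \<in> J \<and> F \<noteq> 0}"

definition Lambda ::
    "('m monomial \<Rightarrow> 'm monomial \<Rightarrow> bool) \<Rightarrow> ('m, 'a::{field,finite}) mpoly set \<Rightarrow>
     ('m, 'a) mpoly set \<Rightarrow> 'm monomial \<Rightarrow> 'm monomial set" where
  "Lambda prec I H N = {M \<in> footprint prec (field_ideal I).
     \<forall>F. F \<noteq> 0 \<and> lm prec F = M \<and> Poly_Mapping.keys F \<subseteq> footprint prec (field_ideal I) \<longrightarrow>
       (\<exists>K P. K * F + (\<Sum>h\<in>H. P h * h) \<noteq> 0 \<and> lm prec (K * F + (\<Sum>h\<in>H. P h * h)) = N)}"

definition ev :: "('m::finite \<Rightarrow> 'a::comm_ring_1) list \<Rightarrow> ('m, 'a) mpoly \<Rightarrow> 'a vec" where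
  "ev Ps F = vec (length Ps) (\<lambda>j. peval F (Ps ! j))"

definition ev_code :: "('m::finite \<Rightarrow> 'a::field) list \<Rightarrow> 'm monomial set \<Rightarrow> 'a vec set" where
  "ev_code Ps L = LinearCombinations.module.span class_ring (module_vec TYPE('a) (length Ps))
     ((\<lambda>M. ev Ps (Poly_Mapping.single M 1)) ` L)"

definition dual_ev_code :: "('m::finite \<Rightarrow> 'a::field) list \<Rightarrow> 'm monomial set \<Rightarrow> 'a vec set" where
  "dual_ev_code Ps L = vec_module.orthogonal_complement (length Ps) (ev_code Ps L)"

definition hamming_weight :: "'a::zero vec \<Rightarrow> nat" where
  "hamming_weight c = card {j. j < dim_vec c \<and> c $ j \<noteq> 0}"

text \<open>A minimum over a set of naturals is taken as an infimum in \<^typ>\<open>enat\<close>: it is attained if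
  the set is nonempty, and is \<open>\<infinity>\<close> otherwise (e.g. the minimum distance of the zero code).\<close>

definition rel_distance :: "'a::zero vec set \<Rightarrow> 'a vec set \<Rightarrow> enat" where
  "rel_distance C C' = (INF c\<in>C - C'. enat (hamming_weight c))"

definition min_distance :: "'a::zero vec set \<Rightarrow> enat" where
  "min_distance C = (INF c\<in>{c \<in> C. c \<noteq> 0\<^sub>v (dim_vec c)}. enat (hamming_weight c))"

end

theory Submission
  imports Defs
begin

text \<open>
  Let \<open>c \<noteq> 0\<close> be orthogonal to \<open>ev M\<close> for every \<open>M\<close> of the footprint below \<open>N\<close>, but not to \<open>ev N\<close>. If \<open>F \<noteq> 0\<close>
  is supported on \<open>\<Lambda>(N)\<close>, then \<open>\<langle>F\<rangle> + I\<^sub>q\<close> contains a polynomial with leading monomial \<open>N\<close>.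
  Its evaluation is the componentwise product \<open>ev K * ev F\<close>, and reducing its tail to the footprint
  shows that \<open>c\<close> is not orthogonal to it; hence \<open>c * ev F \<noteq> 0\<close>. So \<open>F \<mapsto> c * ev F\<close> is injective on the
  polynomials supported on \<open>\<Lambda>(N)\<close>, with values in the vectors supported on the support of \<open>c\<close>,
  and counting over the finite field gives \<open>#\<Lambda>(N) \<le> w\<^sub>H(c)\<close>. Such an \<open>N\<close> exists because Lagrange
  interpolation and reduction show that the evaluations of the footprint span the whole space.
\<close>

section \<open>Evaluation\<close>

text \<open>The added terms have coefficient zero, so two polynomials can be evaluated over a common
  index set, as additivity requires.\<close>

lemma peval_superset:
  assumes "finite A" "Poly_Mapping.keys F \<subseteq> A"
  shows "peval F x = (\<Sum>t\<in>A. Poly_Mapping.lookup F t * (\<Prod>i\<in>UNIV. x i ^ Poly_Mapping.lookup t i))"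
  unfolding peval_def using assms
  by (intro sum.mono_neutral_left) (auto simp: in_keys_iff)

lemma peval_0 [simp]: "peval 0 x = 0"
  by (simp add: peval_def)

lemma peval_single:
  "peval (Poly_Mapping.single t a) x = a * (\<Prod>i\<in>UNIV. x i ^ Poly_Mapping.lookup t i)"
  by (subst peval_superset[of "{t}"]) auto

lemma peval_1 [simp]: "peval 1 x = 1"
  using peval_single[of 0 1 x] by simp

lemma peval_add: "peval (F + G) x = peval F x + peval G x"
  using Poly_Mapping.keys_add[of F G]
  by (simp add: peval_superset[of "Poly_Mapping.keys F \<union> Poly_Mapping.keys G"] lookup_add
      algebra_simps sum.distrib)

lemma peval_sum: "peval (\<Sum>a\<in>A. f a) x = (\<Sum>a\<in>A. peval (f a) x)"
  by (induction A rule: infinite_finite_induct) (auto simp: peval_add)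

lemma peval_diff: "peval (F - G) x = peval F x - peval G x"
  using peval_add[of "F - G" G x] by simp

lemma poly_mapping_sum_single:
  "F = (\<Sum>t\<in>Poly_Mapping.keys F. Poly_Mapping.single t (Poly_Mapping.lookup F t))"
proof (rule poly_mapping_eqI)
  fix k
  show "Poly_Mapping.lookup F k =
    Poly_Mapping.lookup (\<Sum>t\<in>Poly_Mapping.keys F. Poly_Mapping.single t (Poly_Mapping.lookup F t)) k"
    by (simp add: lookup_sum lookup_single when_def in_keys_iff)
qed

lemma peval_single_mult:
  "peval (Poly_Mapping.single s a * Poly_Mapping.single t b) x =
    peval (Poly_Mapping.single s a) x * peval (Poly_Mapping.single t b) x"
  by (simp add: mult_single peval_single lookup_add power_add prod.distrib algebra_simps)

lemma peval_mult: "peval (F * G) x = peval F x * peval G x"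
proof -
  have "peval (F * G) x =
    peval ((\<Sum>s\<in>Poly_Mapping.keys F. Poly_Mapping.single s (Poly_Mapping.lookup F s)) *
           (\<Sum>t\<in>Poly_Mapping.keys G. Poly_Mapping.single t (Poly_Mapping.lookup G t))) x"
    by (simp flip: poly_mapping_sum_single)
  also have "\<dots> =
    peval (\<Sum>s\<in>Poly_Mapping.keys F. Poly_Mapping.single s (Poly_Mapping.lookup F s)) x *
    peval (\<Sum>t\<in>Poly_Mapping.keys G. Poly_Mapping.single t (Poly_Mapping.lookup G t)) x"
    by (simp add: sum_product peval_sum peval_single_mult)
  finally show ?thesis
    by (simp flip: poly_mapping_sum_single)
qed

lemma peval_prod: "peval (\<Prod>a\<in>A. f a) x = (\<Prod>a\<in>A. peval (f a) x)"
  by (induction A rule: infinite_finite_induct) (auto simp: peval_mult)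

lemma peval_indet: "peval (indet i) x = x i"
proof -
  have "x k ^ Poly_Mapping.lookup (Poly_Mapping.single i 1) k = (if k = i then x k else 1)" for k
    by (simp add: lookup_single when_def)
  then show ?thesis
    by (simp add: indet_def peval_single)
qed

text \<open>One linear factor for each point of \<open>S\<close> other than \<open>p\<close> gives
  the numerator of the Lagrange polynomial; over a field its value at \<open>p\<close> is a product
  of nonzero factors.\<close>

lemma interpolating_polynomial:
  fixes p :: "'m::finite \<Rightarrow> 'a::field"
  assumes "finite S"
  obtains F where "peval F p \<noteq> 0" "\<And>x. x \<in> S \<Longrightarrow> x \<noteq> p \<Longrightarrow> peval F x = 0"
proof -
  \<comment> \<open>\<open>d x\<close> is a coordinate separating \<open>x\<close> from
    \<open>p\<close>; the choice is meaningful only for \<open>x \<noteq> p\<close>, hence the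
    product below runs over \<open>S - {p}\<close>.\<close>
  define d where "d x = (SOME i. x i \<noteq> p i)" for x
  have d: "x (d x) \<noteq> p (d x)" if "x \<noteq> p" for x
    using that unfolding d_def fun_eq_iff by (metis (mono_tags, lifting) someI_ex)
  define F where "F = (\<Prod>y\<in>S - {p}. indet (d y) - Poly_Mapping.single 0 (y (d y)))"
  have F: "peval F x = (\<Prod>y\<in>S - {p}. x (d y) - y (d y))" for x
    by (simp add: F_def peval_prod peval_diff peval_indet peval_single)
  show thesis
  proof
    show "peval F p \<noteq> 0"
      using d assms by (force simp: F)
    show "peval F x = 0" if "x \<in> S" "x \<noteq> p" for x
      using that assms by (auto simp: F)
  qed
qed

section \<open>Reduction to the footprint\<close>

text \<open>A finite nonempty set of monomials has a greatest element by totality and transitivity;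
  irreflexivity makes it unique, so the description in \<open>lm\<close> denotes it.\<close>

lemma lm_props:
  fixes F :: "('m, 'a::zero) mpoly"
  assumes ord: "monomial_ordering prec" and "F \<noteq> 0"
  shows "lm prec F \<in> Poly_Mapping.keys F"
    and "s \<in> Poly_Mapping.keys F \<Longrightarrow> s \<noteq> lm prec F \<Longrightarrow> prec s (lm prec F)"
proof -
  have tr: "transp prec" and tot: "totalp prec" and irr: "irreflp prec"
    using ord by (auto simp: monomial_ordering_def)
  have ex: "\<exists>t\<in>A. \<forall>s\<in>A. s \<noteq> t \<longrightarrow> prec s t" if "finite A" "A \<noteq> {}" for A
    using that
  proof (induction A rule: finite_ne_induct)
    case (insert a A)
    then obtain t where t: "t \<in> A" "\<forall>s\<in>A. s \<noteq> t \<longrightarrow> prec s t"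
      by blast
    have "prec a t \<or> prec t a"
      using tot insert.hyps t(1) by (metis totalpD)
    then show ?case
      using t tr by (metis insert_iff transpD)
  qed simp
  have "Poly_Mapping.keys F \<noteq> {}"
    using \<open>F \<noteq> 0\<close> by simp
  from ex[OF finite_keys this] obtain t
    where t: "t \<in> Poly_Mapping.keys F" "\<forall>s\<in>Poly_Mapping.keys F. s \<noteq> t \<longrightarrow> prec s t"
    by blast
  have "lm prec F = t"
    unfolding lm_def using t irr tr
    by (intro the_equality) (auto dest: transpD irreflpD)
  then show "lm prec F \<in> Poly_Mapping.keys F"
    and "s \<in> Poly_Mapping.keys F \<Longrightarrow> s \<noteq> lm prec F \<Longrightarrow> prec s (lm prec F)"
    using t by auto
qed

section \<open>Closure properties of ideals and of \<open>field_ideal\<close>\<close>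

lemma ideal_add: "is_ideal J \<Longrightarrow> F \<in> J \<Longrightarrow> G \<in> J \<Longrightarrow> F + G \<in> J"
  unfolding is_ideal_def by (rule Modules.module.subspace_add[OF module_self])

lemma ideal_mult: "is_ideal J \<Longrightarrow> F \<in> J \<Longrightarrow> K * F \<in> J"
  unfolding is_ideal_def by (rule Modules.module.subspace_scale[OF module_self])

lemma ideal_0: "is_ideal J \<Longrightarrow> 0 \<in> J"
  unfolding is_ideal_def by (rule Modules.module.subspace_0[OF module_self])

lemma is_ideal_field_ideal:
  fixes I :: "('m, 'a::{field,finite}) mpoly set"
  assumes "is_ideal I"
  shows "is_ideal (field_ideal I)"
proof -
  let ?B = "ideal_gen (range (\<lambda>i. indet i ^ CARD('a) - indet i)) :: ('m, 'a) mpoly set"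
  have B: "is_ideal ?B"
    unfolding is_ideal_def ideal_gen_def by (rule Modules.module.subspace_span[OF module_self])
  show ?thesis
    unfolding is_ideal_def
  proof (rule Modules.module.subspaceI[OF module_self])
    show "0 \<in> field_ideal I"
      using ideal_0[OF assms] ideal_0[OF B] unfolding field_ideal_def by force
  next
    fix x y
    assume "x \<in> field_ideal I" "y \<in> field_ideal I"
    then obtain F G F' G' where *: "x = F + G" "y = F' + G'" "F \<in> I" "F' \<in> I" "G \<in> ?B" "G' \<in> ?B"
      unfolding field_ideal_def by blast
    have "x + y = (F + F') + (G + G')"
      by (simp add: * algebra_simps)
    moreover have "F + F' \<in> I" "G + G' \<in> ?B"
      using * ideal_add[OF assms] ideal_add[OF B] by auto
    ultimately show "x + y \<in> field_ideal I"
      unfolding field_ideal_def by auto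
  next
    fix c x
    assume "x \<in> field_ideal I"
    then obtain F G where "x = F + G" "F \<in> I" "G \<in> ?B"
      unfolding field_ideal_def by blast
    then show "c * x \<in> field_ideal I"
      using ideal_mult[OF assms, of F c] ideal_mult[OF B, of G c]
      by (auto simp: field_ideal_def distrib_left)
  qed
qed

text \<open>Division with remainder by well-founded induction on the bound \<open>u\<close>: the
  term at \<open>u\<close> is kept if \<open>u\<close> lies in the footprint and cancelled by an
  element of \<open>J\<close> otherwise. The bound on the remainder is what later keeps reductions
  below a given monomial.\<close>

lemma reduce_bounded:
  fixes J :: "('m, 'a::field) mpoly set"
  assumes ord: "monomial_ordering prec" and J: "is_ideal J"
  shows "Poly_Mapping.keys F \<subseteq> {s. s = u \<or> prec s u} \<Longrightarrow>
    \<exists>G. Poly_Mapping.keys G \<subseteq> footprint prec J \<inter> {s. s = u \<or> prec s u} \<and> F - G \<in> J"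
proof -
  have tr: "transp prec" and wf: "wfp prec"
    using ord by (auto simp: monomial_ordering_def)
  show "Poly_Mapping.keys F \<subseteq> {s. s = u \<or> prec s u} \<Longrightarrow> ?thesis"
  proof (induction u arbitrary: F rule: wfp_induct_rule[OF wf])
    case (1 u)
    define a where "a = Poly_Mapping.lookup F u"
    \<comment> \<open>\<open>E\<close> removes the term of \<open>F\<close> at \<open>u\<close>
      without introducing terms above \<open>u\<close>, and itself reduces to a remainder supported
      at most on \<open>u\<close>.\<close>
    obtain E where E: "Poly_Mapping.keys (F - E) \<subseteq> {s. prec s u}"
      and E': "\<exists>G. Poly_Mapping.keys G \<subseteq> footprint prec J \<inter> {u} \<and> E - G \<in> J"
    proof (cases "u \<in> footprint prec J")
      case True
      show thesis
      proof (rule that[of "Poly_Mapping.single u a"])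
        show "Poly_Mapping.keys (F - Poly_Mapping.single u a) \<subseteq> {s. prec s u}"
          using 1(2) by (auto simp: in_keys_iff lookup_minus lookup_single when_def a_def split: if_splits)
        show "\<exists>G. Poly_Mapping.keys G \<subseteq> footprint prec J \<inter> {u} \<and> Poly_Mapping.single u a - G \<in> J"
          using True ideal_0[OF J] by (intro exI[of _ "Poly_Mapping.single u a"]) auto
      qed
    next
      case False
      then obtain P where P: "P \<in> J" "P \<noteq> 0" "lm prec P = u"
        by (auto simp: footprint_def)
      define b where "b = Poly_Mapping.lookup P u"
      have b: "b \<noteq> 0"
        using lm_props(1)[OF ord P(2)] P(3) by (simp add: in_keys_iff b_def)
      \<comment> \<open>A constant factor suffices to match the coefficient of \<open>F\<close> at
        \<open>u\<close>, since \<open>P\<close> has leading monomial exactly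
        \<open>u\<close>.\<close>
      define E where "E = Poly_Mapping.single 0 (a / b) * P"
      have lookup_E: "Poly_Mapping.lookup E s = a / b * Poly_Mapping.lookup P s" for s
        unfolding E_def mult_map_scale_conv_mult[symmetric]
        by (simp add: Poly_Mapping.map.rep_eq when_def)
      show thesis
      proof (rule that[of E])
        have "prec s u" if "s \<in> Poly_Mapping.keys (F - E)" for s
        proof -
          have "s \<noteq> u"
            using that b by (auto simp: in_keys_iff lookup_minus lookup_E a_def b_def)
          moreover have "s \<in> Poly_Mapping.keys F \<or> s \<in> Poly_Mapping.keys P"
            using that by (auto simp: in_keys_iff lookup_minus lookup_E)
          ultimately show ?thesis
            using 1(2) lm_props(2)[OF ord P(2)] P(3) by blast
        qed
        then show "Poly_Mapping.keys (F - E) \<subseteq> {s. prec s u}"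
          by blast
        show "\<exists>G. Poly_Mapping.keys G \<subseteq> footprint prec J \<inter> {u} \<and> E - G \<in> J"
          using ideal_mult[OF J P(1)] by (intro exI[of _ 0]) (simp add: E_def)
      qed
    qed
    from E' obtain G1 where G1: "Poly_Mapping.keys G1 \<subseteq> footprint prec J \<inter> {u}" "E - G1 \<in> J"
      by blast
    have "\<exists>G. Poly_Mapping.keys G \<subseteq> footprint prec J \<inter> {s. prec s u} \<and> (F - E) - G \<in> J"
    \<comment> \<open>The induction hypothesis is applied at the leading monomial of
      \<open>F - E\<close>, which has a meaning only for a nonzero difference.\<close>
    proof (cases "F - E = 0")
      case True
      then show ?thesis
        using ideal_0[OF J] by (intro exI[of _ 0]) simp
    next
      case False
      let ?v = "lm prec (F - E)"
      have "prec ?v u"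
        using lm_props(1)[OF ord False] E by blast
      moreover have "Poly_Mapping.keys (F - E) \<subseteq> {s. s = ?v \<or> prec s ?v}"
        using lm_props(2)[OF ord False] by blast
      ultimately obtain G where "Poly_Mapping.keys G \<subseteq> footprint prec J \<inter> {s. s = ?v \<or> prec s ?v}"
        "(F - E) - G \<in> J"
        using 1(1) by blast
      then show ?thesis
        using \<open>prec ?v u\<close> tr by (intro exI[of _ G]) (auto dest: transpD)
    qed
    then obtain G2 where G2: "Poly_Mapping.keys G2 \<subseteq> footprint prec J \<inter> {s. prec s u}"
      "(F - E) - G2 \<in> J"
      by blast
    have "F - (G1 + G2) = (E - G1) + ((F - E) - G2)"
      by simp
    then have "F - (G1 + G2) \<in> J"
      using ideal_add[OF J G1(2) G2(2)] by metis
    moreover have "Poly_Mapping.keys (G1 + G2) \<subseteq> footprint prec J \<inter> {s. s = u \<or> prec s u}"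
      using Poly_Mapping.keys_add[of G1 G2] G1(1) G2(1) by blast
    ultimately show ?case
      by blast
  qed
qed

section \<open>The pairing of a word with evaluations\<close>

definition pairing :: "('m::finite \<Rightarrow> 'a::comm_ring_1) list \<Rightarrow> 'a vec \<Rightarrow> ('m, 'a) mpoly \<Rightarrow> 'a" where
  "pairing Ps c F = (\<Sum>j<length Ps. c $ j * peval F (Ps ! j))"

lemma scalar_prod_ev: "c \<bullet> ev Ps F = pairing Ps c F"
  by (simp add: scalar_prod_def ev_def pairing_def lessThan_atLeast0)

lemma pairing_expand:
  "pairing Ps c F = (\<Sum>t\<in>Poly_Mapping.keys F.
      Poly_Mapping.lookup F t * pairing Ps c (Poly_Mapping.single t 1))"
  by (simp add: pairing_def peval_single peval_def sum_distrib_left algebra_simps)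
    (rule sum.swap)

text \<open>Evaluation at points of the variety factors through the quotient by \<open>J\<close>, so
  reduction leaves the pairing unchanged.\<close>

lemma pairing_cong_ideal:
  assumes "F - G \<in> J" "set Ps \<subseteq> variety J"
  shows "pairing Ps c F = pairing Ps c G"
proof -
  have "peval F (Ps ! j) = peval G (Ps ! j)" if "j < length Ps" for j
  proof -
    have "Ps ! j \<in> variety J"
      using that assms(2) by auto
    then have "peval (F - G) (Ps ! j) = 0"
      using assms(1) by (auto simp: variety_def)
    then show ?thesis
      by (simp add: peval_diff)
  qed
  then show ?thesis
    by (simp add: pairing_def)
qed

text \<open>Orthogonality to a span is orthogonality to its generators.\<close>

lemma mem_dual_ev_code:
  "c \<in> dual_ev_code Ps L \<longleftrightarrow>
    c \<in> carrier_vec (length Ps) \<and> (\<forall>N\<in>L. pairing Ps c (Poly_Mapping.single N 1) = 0)"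
proof -
  have "(\<lambda>N. ev Ps (Poly_Mapping.single N 1)) ` L \<subseteq> carrier_vec (length Ps)"
    by (auto simp: ev_def)
  from vec_space.in_orthogonal_complement_span[OF this]
  show ?thesis
    unfolding dual_ev_code_def ev_code_def vec_module.orthogonal_complement_def
    by (auto simp: scalar_prod_ev)
qed

text \<open>Pairing with a polynomial that is nonzero only at the \<open>j\<close>-th point isolates
  the entry \<open>c $ j\<close>. Reducing that polynomial to the footprint keeps the pairing
  nonzero, so some monomial of the remainder must contribute.\<close>

lemma pairing_nonzero_on_footprint:
  fixes c :: "'a::field vec" and Ps :: "('m::finite \<Rightarrow> 'a) list"
  assumes ord: "monomial_ordering prec" and J: "is_ideal J"
    and Ps: "distinct Ps" "set Ps \<subseteq> variety J"
    and j: "j < length Ps" "c $ j \<noteq> 0"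
  shows "\<exists>N\<in>footprint prec J. pairing Ps c (Poly_Mapping.single N 1) \<noteq> 0"
proof -
  obtain F where F: "peval F (Ps ! j) \<noteq> 0"
    "\<And>x. x \<in> set Ps \<Longrightarrow> x \<noteq> Ps ! j \<Longrightarrow> peval F x = 0"
    using interpolating_polynomial[of "set Ps" "Ps ! j"] by auto
  \<comment> \<open>Distinctness of the points turns different positions into different points,
    where \<open>F\<close> vanishes.\<close>
  have "peval F (Ps ! k) = 0" if "k < length Ps" "k \<noteq> j" for k
    using F(2)[of "Ps ! k"] that j Ps(1) by (simp add: nth_eq_iff_index_eq)
  then have "pairing Ps c F = (\<Sum>k<length Ps. if k = j then c $ j * peval F (Ps ! j) else 0)"
    unfolding pairing_def by (intro sum.cong) auto
  then have nz: "pairing Ps c F \<noteq> 0"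
    using F(1) j by simp
  then have "F \<noteq> 0"
    by (auto simp: pairing_def)
  then have "Poly_Mapping.keys F \<subseteq> {s. s = lm prec F \<or> prec s (lm prec F)}"
    using lm_props(2)[OF ord] by blast
  from reduce_bounded[OF ord J this] obtain G
    where G: "Poly_Mapping.keys G \<subseteq> footprint prec J" "F - G \<in> J"
    by blast
  have "pairing Ps c G \<noteq> 0"
    using nz pairing_cong_ideal[OF G(2) Ps(2)] by metis
  then have "\<exists>t\<in>Poly_Mapping.keys G. pairing Ps c (Poly_Mapping.single t 1) \<noteq> 0"
    unfolding pairing_expand[of Ps c G] by (metis (no_types, lifting) mult_zero_right sum.neutral)
  then show ?thesis
    using G(1) by blast
qed

text \<open>All terms of \<open>G\<close> below \<open>N\<close> pair to zero with \<open>c\<close>,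
  so only the leading term survives, with nonzero coefficient and nonzero pairing.\<close>

lemma pairing_nonzero_of_lm:
  fixes c :: "'a::field vec" and G :: "('m::finite, 'a) mpoly"
  assumes ord: "monomial_ordering prec" and J: "is_ideal J"
    and Ps: "set Ps \<subseteq> variety J"
    and N: "pairing Ps c (Poly_Mapping.single N 1) \<noteq> 0"
    and below: "\<And>s. s \<in> footprint prec J \<Longrightarrow> prec s N \<Longrightarrow> pairing Ps c (Poly_Mapping.single s 1) = 0"
    and G: "G \<noteq> 0" "lm prec G = N"
  shows "pairing Ps c G \<noteq> 0"
proof -
  \<comment> \<open>The tail of \<open>G\<close> may leave the footprint, so vanishing is first
    extended to every monomial below \<open>N\<close> by reducing it to footprint monomials that are
    still below \<open>N\<close>.\<close>
  have below_all: "pairing Ps c (Poly_Mapping.single s 1) = 0" if "prec s N" for s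
  proof -
    have "Poly_Mapping.keys (Poly_Mapping.single s (1::'a)) \<subseteq> {t. t = s \<or> prec t s}"
      by simp
    from reduce_bounded[OF ord J this] obtain R
      where R: "Poly_Mapping.keys R \<subseteq> footprint prec J \<inter> {t. t = s \<or> prec t s}"
        "Poly_Mapping.single s 1 - R \<in> J"
      by blast
    have "prec t N" if "t \<in> Poly_Mapping.keys R" for t
      using that R(1) \<open>prec s N\<close> ord by (auto simp: monomial_ordering_def dest: transpD)
    then have "pairing Ps c R = 0"
      unfolding pairing_expand[of Ps c R] using below R(1) by (intro sum.neutral) auto
    then show ?thesis
      using pairing_cong_ideal[OF R(2) Ps] by metis
  qed
  have NG: "N \<in> Poly_Mapping.keys G"
    using lm_props(1)[OF ord G(1)] G(2) by simp
  have "pairing Ps c G = Poly_Mapping.lookup G N * pairing Ps c (Poly_Mapping.single N 1) +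
    (\<Sum>t\<in>Poly_Mapping.keys G - {N}. Poly_Mapping.lookup G t * pairing Ps c (Poly_Mapping.single t 1))"
    unfolding pairing_expand[of Ps c G] using NG by (intro sum.remove) auto
  also have "(\<Sum>t\<in>Poly_Mapping.keys G - {N}.
      Poly_Mapping.lookup G t * pairing Ps c (Poly_Mapping.single t 1)) = 0"
    using lm_props(2)[OF ord G(1)] G(2) below_all by (intro sum.neutral) auto
  finally show ?thesis
    using N NG by (simp add: in_keys_iff)
qed

section \<open>The weight bound\<close>

lemma card_Lambda_le_hamming_weight:
  fixes c :: "'a::{field,finite} vec" and I :: "('m::finite, 'a) mpoly set"
  assumes ord: "monomial_ordering prec" and I: "is_ideal I"
    and H: "H \<subseteq> field_ideal I"
    and Ps: "set Ps \<subseteq> variety (field_ideal I)"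
    and fin: "finite (footprint prec (field_ideal I))"
    and c: "c \<in> carrier_vec (length Ps)"
    and N: "pairing Ps c (Poly_Mapping.single N 1) \<noteq> 0"
    and below: "\<And>s. s \<in> footprint prec (field_ideal I) \<Longrightarrow> prec s N \<Longrightarrow>
      pairing Ps c (Poly_Mapping.single s 1) = 0"
  shows "card (Lambda prec I H N) \<le> hamming_weight c"
proof -
  let ?J = "field_ideal I" and ?\<Lambda> = "Lambda prec I H N"
  define S where "S = {j. j < length Ps \<and> c $ j \<noteq> 0}"
  have J: "is_ideal ?J"
    using I by (rule is_ideal_field_ideal)
  have \<Lambda>: "?\<Lambda> \<subseteq> footprint prec ?J" "finite ?\<Lambda>"
    using fin by (auto simp: Lambda_def elim: finite_subset[rotated])
  have peval_H: "peval h (Ps ! j) = 0" if "h \<in> H" "j < length Ps" for h j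
  proof -
    have "Ps ! j \<in> variety ?J" "h \<in> ?J"
      using that Ps H by auto
    then show ?thesis
      by (auto simp: variety_def)
  qed
  \<comment> \<open>This is injectivity in kernel form: a polynomial supported on
    \<open>?\<Lambda>\<close> is determined by its values at the points where \<open>c\<close> is
    nonzero.\<close>
  have key: "F = 0" if keys: "Poly_Mapping.keys F \<subseteq> ?\<Lambda>"
    and zero: "\<And>j. j \<in> S \<Longrightarrow> peval F (Ps ! j) = 0" for F
  proof (rule ccontr)
    assume "F \<noteq> 0"
    then have "lm prec F \<in> ?\<Lambda>"
      using lm_props(1)[OF ord] keys by blast
    then obtain K P where KP: "K * F + (\<Sum>h\<in>H. P h * h) \<noteq> 0"
      "lm prec (K * F + (\<Sum>h\<in>H. P h * h)) = N"
      using \<open>F \<noteq> 0\<close> keys \<Lambda>(1) unfolding Lambda_def by blast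
    have "pairing Ps c (K * F + (\<Sum>h\<in>H. P h * h)) \<noteq> 0"
      using pairing_nonzero_of_lm[OF ord J Ps N below KP] .
    \<comment> \<open>At each point the multiples of \<open>H\<close> vanish, and either
      \<open>c $ j\<close> is zero or \<open>F\<close> vanishes by assumption.\<close>
    moreover have "c $ j * peval (K * F + (\<Sum>h\<in>H. P h * h)) (Ps ! j) = 0" if "j < length Ps" for j
      using that zero[of j] peval_H[of _ j]
      by (cases "c $ j = 0") (auto simp: S_def peval_add peval_mult peval_sum)
    ultimately show False
      by (simp add: pairing_def)
  qed
  define poly where "poly f = (\<Sum>t\<in>?\<Lambda>. Poly_Mapping.single t (f t))" for f :: "'m monomial \<Rightarrow> 'a"
  have lookup_poly: "Poly_Mapping.lookup (poly f) t = (if t \<in> ?\<Lambda> then f t else 0)" for f t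
    using \<Lambda>(2) by (simp add: poly_def lookup_sum lookup_single when_def)
  \<comment> \<open>Restricting to \<open>S\<close> plays the part of multiplying by
    \<open>c\<close>. Extensional functions on both sides make the counts exact powers of the field
    size.\<close>
  define \<phi> where "\<phi> f = restrict (\<lambda>j. peval (poly f) (Ps ! j)) S" for f
  have "inj_on \<phi> (?\<Lambda> \<rightarrow>\<^sub>E UNIV)"
  proof (rule inj_onI)
    fix f g
    assume fg: "f \<in> ?\<Lambda> \<rightarrow>\<^sub>E UNIV" "g \<in> ?\<Lambda> \<rightarrow>\<^sub>E UNIV" and eq: "\<phi> f = \<phi> g"
    have "poly f - poly g = 0"
    proof (rule key)
      show "Poly_Mapping.keys (poly f - poly g) \<subseteq> ?\<Lambda>"
        by (auto simp: in_keys_iff lookup_minus lookup_poly split: if_splits)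
      show "peval (poly f - poly g) (Ps ! j) = 0" if "j \<in> S" for j
        using fun_cong[OF eq, of j] that by (simp add: \<phi>_def peval_diff)
    qed
    then have "f t = g t" if "t \<in> ?\<Lambda>" for t
      using that lookup_poly[of f t] lookup_poly[of g t] by simp
    then show "f = g"
      by (rule PiE_ext[OF fg])
  qed
  moreover have "\<phi> ` (?\<Lambda> \<rightarrow>\<^sub>E UNIV) \<subseteq> S \<rightarrow>\<^sub>E UNIV"
    by (auto simp: \<phi>_def)
  moreover have finS: "finite S"
    by (simp add: S_def)
  then have "finite (S \<rightarrow>\<^sub>E (UNIV :: 'a set))"
    by (intro finite_PiE) auto
  ultimately have "card (?\<Lambda> \<rightarrow>\<^sub>E (UNIV :: 'a set)) \<le> card (S \<rightarrow>\<^sub>E (UNIV :: 'a set))"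
    by (rule card_inj_on_le)
  then have "CARD('a) ^ card ?\<Lambda> \<le> CARD('a) ^ card S"
    using \<Lambda>(2) finS by (simp add: card_PiE)
  \<comment> \<open>Exponents of equal powers can be compared only for a base above 1; the distinct
    elements 0 and 1 provide it.\<close>
  moreover have "1 < CARD('a)"
    using card_mono[of "UNIV :: 'a set" "{0, 1}"] by simp
  ultimately have "card ?\<Lambda> \<le> card S"
    by (metis power_le_imp_le_exp)
  moreover have "S = {j. j < dim_vec c \<and> c $ j \<noteq> 0}"
    using c by (auto simp: S_def)
  ultimately show ?thesis
    by (simp add: hamming_weight_def)
qed

section \<open>From the weight bound to the minimum and relative distances\<close>

theorem theorem9:
  fixes I :: "('m::finite, 'a::{field,finite}) mpoly set"
    and prec :: "'m monomial \<Rightarrow> 'm monomial \<Rightarrow> bool"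
    and H :: "('m, 'a) mpoly set"
    and Ps :: "('m \<Rightarrow> 'a) list"
    and n :: nat
    and M :: "nat \<Rightarrow> 'm monomial"
    and \<mu> :: "'m monomial \<Rightarrow> nat"
  assumes "is_ideal I"
    and "monomial_ordering prec"
    and "groebner_basis prec (field_ideal I) H"
    and "distinct Ps" and "set Ps = variety (field_ideal I)"
    and "footprint prec (field_ideal I) = M ` {1..n}"
    and "\<And>i j. 1 \<le> i \<Longrightarrow> i < j \<Longrightarrow> j \<le> n \<Longrightarrow> prec (M i) (M j)"
    and "\<And>i. 1 \<le> i \<Longrightarrow> i \<le> n \<Longrightarrow> \<mu> (M i) \<le> card (Lambda prec I H (M i))"
  shows "(\<forall>L \<subseteq> footprint prec (field_ideal I).
            min_distance (dual_ev_code Ps L)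
              \<ge> (INF N\<in>{N \<in> footprint prec (field_ideal I). N \<notin> L}. enat (\<mu> N))) \<and>
         (\<forall>L1 L2. L2 \<subset> L1 \<and> L1 \<subseteq> footprint prec (field_ideal I) \<longrightarrow>
            rel_distance (dual_ev_code Ps L2) (dual_ev_code Ps L1)
              \<ge> (INF i\<in>{i \<in> {1..n}. M i \<notin> L2 \<and> i \<le> Max {i \<in> {1..n}. M i \<in> L1}}.
                    enat (\<mu> (M i))))"
proof -
  let ?J = "field_ideal I"
  let ?pair = "\<lambda>c N. pairing Ps c (Poly_Mapping.single N 1)"
  have J: "is_ideal ?J"
    using assms(1) by (rule is_ideal_field_ideal)
  have order: "\<And>s. \<not> prec s s" "\<And>s t. prec s t \<Longrightarrow> \<not> prec t s"
    using assms(2) by (auto simp: monomial_ordering_def dest: irreflpD transpD)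
  \<comment> \<open>Both claims follow from this: the index \<open>i\<close> is the first at which
    \<open>c\<close> fails to be orthogonal. Keeping \<open>i\<close> at most \<open>j\<close>
    yields the cutoff in the relative case.\<close>
  have bound: "\<exists>i\<in>{1..j}. ?pair c (M i) \<noteq> 0 \<and> \<mu> (M i) \<le> hamming_weight c"
    if c: "c \<in> carrier_vec (length Ps)" and j: "j \<in> {1..n}" "?pair c (M j) \<noteq> 0" for c j
  proof -
    define i where "i = (LEAST i. 1 \<le> i \<and> ?pair c (M i) \<noteq> 0)"
    have i: "1 \<le> i" "?pair c (M i) \<noteq> 0"
      using LeastI[of "\<lambda>i. 1 \<le> i \<and> ?pair c (M i) \<noteq> 0" j] j by (auto simp: i_def)
    have least: "i \<le> k" if "1 \<le> k" "?pair c (M k) \<noteq> 0" for k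
      unfolding i_def using that by (intro Least_le) auto
    have "i \<le> j"
      using least[of j] j by auto
    have "card (Lambda prec I H (M i)) \<le> hamming_weight c"
    proof (rule card_Lambda_le_hamming_weight[OF assms(2,1) _ _ _ c i(2)])
      show "H \<subseteq> ?J"
        using assms(3) by (simp add: groebner_basis_def)
      \<comment> \<open>A footprint monomial below \<open>M i\<close> has a smaller index because
        the enumeration is increasing, so minimality of \<open>i\<close> applies.\<close>
      show "?pair c s = 0" if s: "s \<in> footprint prec ?J" "prec s (M i)" for s
      proof -
        obtain k where k: "k \<in> {1..n}" "s = M k"
          using s(1) assms(6) by auto
        have "k < i"
          using assms(7)[of i k] k s(2) i(1) order by (metis atLeastAtMost_iff linorder_neqE_nat)
        then show ?thesis
          using least[of k] k by force
      qed
    qed (use assms(5,6) in auto)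
    then show ?thesis
      using assms(8)[of i] i \<open>i \<le> j\<close> j(1) by (intro bexI[of _ i]) auto
  qed
  show ?thesis
  proof (intro conjI allI impI)
    fix L
    assume "L \<subseteq> footprint prec ?J"
    show "min_distance (dual_ev_code Ps L) \<ge> (INF N\<in>{N \<in> footprint prec ?J. N \<notin> L}. enat (\<mu> N))"
      unfolding min_distance_def
    proof (rule INF_greatest)
      fix c
      assume "c \<in> {c \<in> dual_ev_code Ps L. c \<noteq> 0\<^sub>v (dim_vec c)}"
      then have c: "c \<in> carrier_vec (length Ps)" "\<forall>N\<in>L. ?pair c N = 0" "c \<noteq> 0\<^sub>v (dim_vec c)"
        by (auto simp: mem_dual_ev_code)
      then obtain k where "k < length Ps" "c $ k \<noteq> 0"
        by (metis carrier_vecD eq_vecI index_zero_vec)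
      then obtain N where "N \<in> footprint prec ?J" "?pair c N \<noteq> 0"
        using pairing_nonzero_on_footprint[OF assms(2) J assms(4)] assms(5) by blast
      then obtain j where "j \<in> {1..n}" "?pair c (M j) \<noteq> 0"
        using assms(6) by auto
      from bound[OF c(1) this] this obtain i
        where "i \<in> {1..n}" "?pair c (M i) \<noteq> 0" "\<mu> (M i) \<le> hamming_weight c"
        by force
      \<comment> \<open>\<open>M i\<close> lies outside \<open>L\<close>, since \<open>c\<close>
        pairs to zero with every element of \<open>L\<close>.\<close>
      then show "(INF N\<in>{N \<in> footprint prec ?J. N \<notin> L}. enat (\<mu> N)) \<le> enat (hamming_weight c)"
        using c(2) assms(6) by (intro INF_lower2[of "M i"]) auto
    qed
  next
    fix L1 L2
    assume L: "L2 \<subset> L1 \<and> L1 \<subseteq> footprint prec ?J"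
    let ?m = "Max {i \<in> {1..n}. M i \<in> L1}"
    show "rel_distance (dual_ev_code Ps L2) (dual_ev_code Ps L1)
      \<ge> (INF i\<in>{i \<in> {1..n}. M i \<notin> L2 \<and> i \<le> ?m}. enat (\<mu> (M i)))"
      unfolding rel_distance_def
    proof (rule INF_greatest)
      fix c
      assume "c \<in> dual_ev_code Ps L2 - dual_ev_code Ps L1"
      then have c: "c \<in> carrier_vec (length Ps)" "\<forall>N\<in>L2. ?pair c N = 0" "\<exists>N\<in>L1. ?pair c N \<noteq> 0"
        by (auto simp: mem_dual_ev_code)
      \<comment> \<open>Failure of membership in the smaller dual code gives a monomial of
        \<open>L1\<close> that is not orthogonal to \<open>c\<close>; its index is at most
        \<open>?m\<close>.\<close>
      then obtain j where j: "j \<in> {1..n}" "M j \<in> L1" "?pair c (M j) \<noteq> 0"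
        using L assms(6) by (metis (no_types, lifting) imageE subsetD)
      then have "j \<le> ?m"
        by (intro Max_ge) auto
      with bound[OF c(1) j(1,3)] j(1) obtain i
        where "i \<in> {1..n}" "i \<le> ?m" "?pair c (M i) \<noteq> 0" "\<mu> (M i) \<le> hamming_weight c"
        by force
      then show "(INF i\<in>{i \<in> {1..n}. M i \<notin> L2 \<and> i \<le> ?m}. enat (\<mu> (M i)))
        \<le> enat (hamming_weight c)"
        using c(2) by (intro INF_lower2[of i]) auto
    qed
  qed
qed

end
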